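(* Let $n\ge0$ be an integer and suppose $x=\tau_0^{\epsilon_0}\cdots\tau_n^{\epsilon_n}\xi_1^{r_1}\cdots\xi_n^{r_n}\in A_{C_2}^\vee(n)$ is a monic monomial in standard form, with binary digits $c_{i,j}$ of the exponents $r_i$. Then the directed graph $G_x^{\mathrm{dir}}$ is unilateral if and only if both of the following hold: (1) the integers $$U(r,s):=\sum_{t=1}^{n}\ \sum_{(b_0,\dots,b_t)\in T_t''(r,s)}\ \prod_{k=1}^{t} c_{b_k-b_{k-1},\ b_{k-1}}$$ are positive for all integers $r,s$ with $0\le r<s\le n$; (2) $x$ is divisible by $\tau_0$.
   Context: Let $\mathbb{M}_2=\mathbb{F}_2[a,u]\oplus\frac{\mathbb{F}_2[a,u]}{(a^\infty,u^\infty)}\{\theta\}$ be the bigraded coefficient ring ($RO(C_2)$-graded homology of a point with coefficients in the constant Mackey functor $\underline{\mathbb{F}}_2$), $|a|=(-1,-1)$, $|u|=(0,-1)$. Let $A_{C_2}^\vee(n)=\mathbb{M}_2[\xi_1,\dots,\xi_n,\tau_0,\dots,\tau_n]/(\xi_i^{2^{n-i+1}},\ \tau_i^2=(u+a\tau_0)\xi_{i+1}+a\tau_{i+1})$ with $\xi_{n+1}=\tau_{n+1}=0$, a quotient of the $C_2$-equivariant dual Steenrod algebra. A monic monomial in standard form is $x=\tau_0^{\epsilon_0}\cdots\tau_n^{\epsilon_n}\xi_1^{r_1}\cdots\xi_n^{r_n}$ with $\epsilon_i\in\{0,1\}$, $0\le r_i\le2^{n+1-i}-1$, the exponents being written in binary: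 $r_i=\sum_{j=0}^{n-i}c_{i,j}2^j$, $c_{i,j}\in\{0,1\}$. Divisibility of monomials in standard form is exponentwise; $x$ is divisible by $\tau_0$ iff $\epsilon_0=1$. The graph $G_x$ is the undirected graph with vertex set $\{\sigma,\rho,2\rho,2^2\rho,\dots,2^n\rho\}$ ($n+2$ distinct vertices; $\sigma$ is the sign representation and $\rho=1+\sigma$ the regular representation of $C_2$) having: an edge (labelled $\tau_i$) between $\sigma$ and $2^i\rho$ for each $i$ with $\epsilon_i=1$; an edge (labelled $\xi_i^{2^j}$) between $2^j\rho$ and $2^{i+j}\rho$ for all $1\le i\le n$, $0\le j\le n-i$ with $c_{i,j}=1$; and no other edges. $G_x^{\mathrm{dir}}$ is $G_x$ with every edge oriented towards the vertex of larger representation dimension ($\sigma\to2^i\rho$, $2^j\rho\to2^{i+j}\rho$). A directed graph is unilateral if for every pair of distinct vertices $v,w$ there is a directed path from $v$ to $w$ or from $w$ to $v$. For $0\le r<s\le n$ and $t\ge1$, $T_t''(r,s)$ is the set of $(t+1)$-tuples $(b_0,\dots,b_t)$ of elements of $\{0,1,\dots,n\}$ with $r=b_0<b_1<\cdots<b_t=s$. *)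

theory Defs
  imports
    "Graph_Theory.Graph_Theory"
    "HOL-Algebra.QuotRing"
    "HOL-Library.Product_Plus"
    "HOL-Library.Z2"
    "HOL-Library.Poly_Mapping"
begin

section \<open>The coefficient ring\<close>

text \<open>
  The monomial a^i u^j of F_2[a,u] is the exponent pair (i,j), so F_2[a,u] is
  \<open>(nat \<times> nat) \<Rightarrow>\<^sub>0 bit\<close>. The same type serves for the second summand
  (F_2[a,u] / (a^\<open>\<infinity>\<close>, u^\<open>\<infinity>\<close>)){theta}, where (i,j) now stands for the basis
  element theta / (a^i u^j). The action is
  a^k u^l . theta / (a^i u^j) = theta / (a^(i-k) u^(j-l)) if k \<open>\<le>\<close> i and l \<open>\<le>\<close> j,
  and 0 otherwise; products of two elements of the second summand vanish.
  The bigrading is not recorded. The action is defined over an arbitrary commutative ring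
  of scalars in place of F_2.
\<close>

lift_definition cone_act ::
    "((nat \<times> nat) \<Rightarrow>\<^sub>0 'b::comm_ring_1) \<Rightarrow> ((nat \<times> nat) \<Rightarrow>\<^sub>0 'b) \<Rightarrow> ((nat \<times> nat) \<Rightarrow>\<^sub>0 'b)"
  is "\<lambda>p m k. \<Sum>s | p s \<noteq> 0. p s * m (k + s)"
proof -
  fix p m :: "nat \<times> nat \<Rightarrow> 'b"
  assume fp: "finite {s. p s \<noteq> 0}" and fm: "finite {s. m s \<noteq> 0}"
  have "{k. (\<Sum>s | p s \<noteq> 0. p s * m (k + s)) \<noteq> 0}
      \<subseteq> (\<Union>s \<in> {s. p s \<noteq> 0}. (\<lambda>k. k + s) -` {s. m s \<noteq> 0})"
    by (force elim!: sum.not_neutral_contains_not_neutral)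
  moreover have "finite (\<Union>s \<in> {s. p s \<noteq> 0}. (\<lambda>k. k + s) -` {s. m s \<noteq> 0})"
    using fp fm by (intro finite_UN_I finite_vimageI) (auto simp: inj_on_def)
  ultimately show "finite {k. (\<Sum>s | p s \<noteq> 0. p s * m (k + s)) \<noteq> 0}"
    by (rule finite_subset)
qed

lemma lookup_cone_act:
  assumes "finite S" "Poly_Mapping.keys p \<subseteq> S"
  shows "poly_mapping.lookup (cone_act p m) k = (\<Sum>s\<in>S. poly_mapping.lookup p s * poly_mapping.lookup m (k + s))"
proof -
  have "poly_mapping.lookup (cone_act p m) k = (\<Sum>s\<in>Poly_Mapping.keys p. poly_mapping.lookup p s * poly_mapping.lookup m (k + s))"
    by transfer simp
  also have "\<dots> = (\<Sum>s\<in>S. poly_mapping.lookup p s * poly_mapping.lookup m (k + s))"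
    using assms by (intro sum.mono_neutral_left) (auto simp: in_keys_iff)
  finally show ?thesis .
qed

lemma cone_act_add_left: "cone_act (p + q) m = cone_act p m + cone_act q m"
proof (rule poly_mapping_eqI)
  fix k
  have "Poly_Mapping.keys (p + q) \<subseteq> Poly_Mapping.keys p \<union> Poly_Mapping.keys q"
    by (rule Poly_Mapping.keys_add)
  then show "poly_mapping.lookup (cone_act (p + q) m) k = poly_mapping.lookup (cone_act p m + cone_act q m) k"
    by (simp add: lookup_add sum.distrib distrib_right
        lookup_cone_act[where S = "Poly_Mapping.keys p \<union> Poly_Mapping.keys q"])
qed

lemma cone_act_add_right: "cone_act p (m + l) = cone_act p m + cone_act p l"
  by (rule poly_mapping_eqI)
    (simp add: lookup_add sum.distrib distrib_left
      lookup_cone_act[of "Poly_Mapping.keys p" p])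

lemma cone_act_zero [simp]: "cone_act 0 m = 0" "cone_act p 0 = 0"
  by (rule poly_mapping_eqI, simp add: lookup_cone_act[of "{}"],
      rule poly_mapping_eqI, simp add: lookup_cone_act[of "Poly_Mapping.keys p" p])

lemma lookup_cone_act_single:
  "poly_mapping.lookup (cone_act (Poly_Mapping.single s c) m) k = c * poly_mapping.lookup m (k + s)"
  by (simp add: lookup_cone_act[of "{s}"])

lemma cone_act_one [simp]: "cone_act 1 m = m"
  by (rule poly_mapping_eqI) (simp add: lookup_cone_act[of "{0}"])

lemma poly_mapping_add_induct [case_names zero single add]:
  fixes p :: "'a \<Rightarrow>\<^sub>0 'b::comm_monoid_add"
  assumes "P 0" "\<And>k c. P (Poly_Mapping.single k c)"
    and "\<And>p q. P p \<Longrightarrow> P q \<Longrightarrow> P (p + q)"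
  shows "P p"
proof (induction p rule: Poly_Mapping.update_induct)
  case const
  then show ?case by (simp add: assms)
next
  case (update f a b)
  have "Poly_Mapping.update a b f = Poly_Mapping.single a b + f"
    using update by (intro poly_mapping_eqI)
      (auto simp: lookup_update lookup_add lookup_single in_keys_iff when_def)
  then show ?case using update assms by simp
qed

lemma cone_act_mult: "cone_act (p * q) m = cone_act p (cone_act q m)"
proof (induction p rule: poly_mapping_add_induct)
  case (single i c)
  show ?case
  proof (induction q rule: poly_mapping_add_induct)
    case (single j d)
    show ?case
      by (rule poly_mapping_eqI)
        (simp only: mult_single lookup_cone_act_single, simp add: mult.assoc add.assoc)
  qed (simp_all add: distrib_left cone_act_add_left cone_act_add_right)
qed (simp_all add: distrib_right cone_act_add_left)

datatype m2 = M2 (pos_cone: "(nat \<times> nat) \<Rightarrow>\<^sub>0 bit") (neg_cone: "(nat \<times> nat) \<Rightarrow>\<^sub>0 bit")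

instantiation m2 :: comm_ring_1
begin

definition "0 = M2 0 0"
definition "1 = M2 1 0"
definition "x + y = M2 (pos_cone x + pos_cone y) (neg_cone x + neg_cone y)"
definition "x - y = M2 (pos_cone x - pos_cone y) (neg_cone x - neg_cone y)"
definition "- x = M2 (- pos_cone x) (- neg_cone x)"
definition "x * y = M2 (pos_cone x * pos_cone y)
  (cone_act (pos_cone x) (neg_cone y) + cone_act (pos_cone y) (neg_cone x))"

instance
  by standard
    (auto simp: zero_m2_def one_m2_def plus_m2_def minus_m2_def uminus_m2_def times_m2_def
      algebra_simps cone_act_add_left cone_act_add_right simp flip: cone_act_mult)

end

definition a_m2 :: m2 where "a_m2 = M2 (Poly_Mapping.single (1, 0) 1) 0"

definition u_m2 :: m2 where "u_m2 = M2 (Poly_Mapping.single (0, 1) 1) 0"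


section \<open>The quotient of the dual Steenrod algebra\<close>

datatype gen = Tau nat | Xi nat

type_synonym expo = "gen \<Rightarrow>\<^sub>0 nat"

type_synonym gen_poly = "expo \<Rightarrow>\<^sub>0 m2"

definition scalar :: "m2 \<Rightarrow> gen_poly" where
  "scalar c = Poly_Mapping.single 0 c"

definition tau :: "nat \<Rightarrow> gen_poly" where
  "tau i = Poly_Mapping.single (Poly_Mapping.single (Tau i) 1) 1"

definition xi :: "nat \<Rightarrow> gen_poly" where
  "xi i = Poly_Mapping.single (Poly_Mapping.single (Xi i) 1) 1"

definition gen_poly_ring :: "gen_poly ring" where
  "gen_poly_ring = \<lparr>carrier = UNIV, mult = (*), one = 1, zero = 0, add = (+)\<rparr>"

text \<open>
  The polynomial ring has generators with all indices; those other than
  tau_0, \<dots>, tau_n, xi_1, \<dots>, xi_n are killed by the last two families of relations.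
  This also provides the convention tau_(n+1) = xi_(n+1) = 0.
\<close>

definition relations :: "nat \<Rightarrow> gen_poly set" where
  "relations n =
     {xi i ^ 2 ^ (n - i + 1) |i. 1 \<le> i \<and> i \<le> n} \<union>
     {(tau i)\<^sup>2 - ((scalar u_m2 + scalar a_m2 * tau 0) * xi (i + 1) + scalar a_m2 * tau (i + 1))
        |i. i \<le> n} \<union>
     {xi i |i. i = 0 \<or> n < i} \<union>
     {tau i |i. n < i}"

definition rel_ideal :: "nat \<Rightarrow> gen_poly set" where
  "rel_ideal n = genideal gen_poly_ring (relations n)"

definition dual_steenrod :: "nat \<Rightarrow> gen_poly set ring" where
  "dual_steenrod n = gen_poly_ring Quot rel_ideal n"

definition residue_class :: "nat \<Rightarrow> gen_poly \<Rightarrow> gen_poly set" where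
  "residue_class n p = a_r_coset gen_poly_ring (rel_ideal n) p"


section \<open>Monic monomials in standard form\<close>

definition standard_expo :: "nat \<Rightarrow> expo \<Rightarrow> bool" where
  "standard_expo n e \<longleftrightarrow>
     Poly_Mapping.keys e \<subseteq> Tau ` {0..n} \<union> Xi ` {1..n} \<and>
     (\<forall>i\<in>{0..n}. poly_mapping.lookup e (Tau i) \<in> {0, 1}) \<and>
     (\<forall>i\<in>{1..n}. poly_mapping.lookup e (Xi i) \<le> 2 ^ (n + 1 - i) - 1)"

definition monomial :: "nat \<Rightarrow> expo \<Rightarrow> gen_poly set" where
  "monomial n e =
     residue_class n ((\<Prod>i=0..n. tau i ^ poly_mapping.lookup e (Tau i)) * (\<Prod>i=1..n. xi i ^ poly_mapping.lookup e (Xi i)))"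

definition standard_monomials :: "nat \<Rightarrow> gen_poly set set" where
  "standard_monomials n = monomial n ` {e. standard_expo n e}"

definition exponents :: "nat \<Rightarrow> gen_poly set \<Rightarrow> expo" where
  "exponents n x = (THE e. standard_expo n e \<and> x = monomial n e)"

definition mono_dvd :: "nat \<Rightarrow> gen_poly set \<Rightarrow> gen_poly set \<Rightarrow> bool" where
  "mono_dvd n y x \<longleftrightarrow> (\<forall>g. poly_mapping.lookup (exponents n y) g \<le> poly_mapping.lookup (exponents n x) g)"

definition tau_exp :: "nat \<Rightarrow> gen_poly set \<Rightarrow> nat \<Rightarrow> nat" where
  "tau_exp n x i = poly_mapping.lookup (exponents n x) (Tau i)"

definition xi_exp :: "nat \<Rightarrow> gen_poly set \<Rightarrow> nat \<Rightarrow> nat" where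
  "xi_exp n x i = poly_mapping.lookup (exponents n x) (Xi i)"

definition xi_digit :: "nat \<Rightarrow> gen_poly set \<Rightarrow> nat \<Rightarrow> nat \<Rightarrow> nat" where
  "xi_digit n x i j = xi_exp n x i div 2 ^ j mod 2"

subsection \<open>The standard form determines its exponents\<close>

lemma gen_poly_ring_simps [simp]:
  "carrier gen_poly_ring = UNIV" "mult gen_poly_ring = (*)" "one gen_poly_ring = 1"
  "zero gen_poly_ring = 0" "add gen_poly_ring = (+)"
  by (simp_all add: gen_poly_ring_def)

lemma cring_gen_poly_ring: "cring gen_poly_ring"
proof (rule cringI)
  show "abelian_group gen_poly_ring"
    by (rule abelian_groupI) (auto simp: add.assoc add.commute intro: exI[of _ "- _"] left_minus)
  show "comm_monoid gen_poly_ring"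
    by (rule comm_monoidI) (auto simp: mult.assoc mult.commute)
qed (auto simp: distrib_right)

lemma ideal_rel_ideal: "ideal (rel_ideal n) gen_poly_ring"
  unfolding rel_ideal_def
  by (rule ring.genideal_ideal) (auto simp: cring.axioms(1)[OF cring_gen_poly_ring])

lemma residue_class_in_carrier: "residue_class n p \<in> carrier (dual_steenrod n)"
  by (auto simp: dual_steenrod_def residue_class_def FactRing_def A_RCOSETS_defs
      a_r_coset_def r_coset_def)

lemma residue_class_eqD:
  assumes "residue_class n p = residue_class n q"
  shows "p - q \<in> rel_ideal n"
proof -
  interpret ideal "rel_ideal n" gen_poly_ring by (rule ideal_rel_ideal)
  have "0 \<in> rel_ideal n" using additive_subgroup.zero_closed[OF is_additive_subgroup] by simp
  then have "p \<in> residue_class n p"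
    unfolding residue_class_def a_r_coset_def r_coset_def by force
  then have "p \<in> residue_class n q" using assms by simp
  then obtain h where "h \<in> rel_ideal n" "p = h + q"
    unfolding residue_class_def a_r_coset_def r_coset_def by force
  then show ?thesis by simp
qed

lemma lookup_mult_zero:
  fixes p q :: "(nat \<times> nat) \<Rightarrow>\<^sub>0 'b::comm_ring_1"
  shows "poly_mapping.lookup (p * q) 0 = poly_mapping.lookup p 0 * poly_mapping.lookup q 0"
proof (induction p rule: poly_mapping_add_induct)
  case (single i c)
  show ?case
  proof (induction q rule: poly_mapping_add_induct)
    case (single j d)
    have "i + j = 0 \<longleftrightarrow> i = 0 \<and> j = 0" by (auto simp: prod_eq_iff)
    then show ?case by (auto simp: mult_single lookup_single when_def)
  qed (simp_all add: distrib_left lookup_add)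
qed (simp_all add: distrib_right lookup_add)

lemma lookup_single_times:
  fixes p :: gen_poly
  shows "poly_mapping.lookup (Poly_Mapping.single i c * p) e =
    (if \<exists>q. e = i + q then c * poly_mapping.lookup p (e - i) else 0)"
proof (induction p rule: poly_mapping_add_induct)
  case (single j d)
  show ?case
  proof (cases "\<exists>q. e = i + q")
    case True
    then show ?thesis by (auto simp: mult_single lookup_single when_def)
  next
    case False
    then have "i + j \<noteq> e" by blast
    then show ?thesis using False by (simp add: mult_single lookup_single when_def)
  qed
qed (simp_all add: distrib_left lookup_add)

definition augment :: "m2 \<Rightarrow> bit" where
  "augment c = poly_mapping.lookup (pos_cone c) 0"

lemma augment_simps [simp]:
  "augment 0 = 0" "augment 1 = 1" "augment (c + d) = augment c + augment d"
  "augment (- c) = - augment c" "augment (c - d) = augment c - augment d"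
  "augment (c * d) = augment c * augment d" "augment a_m2 = 0" "augment u_m2 = 0"
  unfolding augment_def zero_m2_def one_m2_def plus_m2_def uminus_m2_def minus_m2_def
    times_m2_def a_m2_def u_m2_def m2.sel
  by (simp_all only: lookup_add lookup_minus lookup_uminus lookup_mult_zero lookup_zero
      lookup_one_zero) (simp_all add: lookup_single when_def prod_eq_iff)

definition nonstandard_ideal :: "nat \<Rightarrow> gen_poly set" where
  "nonstandard_ideal n =
     {p. \<forall>e. standard_expo n e \<longrightarrow> augment (poly_mapping.lookup p e) = 0}"

lemma standard_expo_add_right:
  assumes "standard_expo n (i + q)"
  shows "standard_expo n q"
proof -
  have le: "poly_mapping.lookup q g \<le> poly_mapping.lookup (i + q) g" for g
    by (simp add: lookup_add)
  have "Poly_Mapping.keys q \<subseteq> Poly_Mapping.keys (i + q)"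
  proof
    fix g
    assume "g \<in> Poly_Mapping.keys q"
    then show "g \<in> Poly_Mapping.keys (i + q)" using le[of g] by (simp add: in_keys_iff)
  qed
  moreover have "poly_mapping.lookup q (Tau k) \<in> {0, 1}" if "k \<in> {0..n}" for k
  proof -
    have "poly_mapping.lookup (i + q) (Tau k) \<in> {0, 1}"
      using assms that by (simp add: standard_expo_def)
    then show ?thesis using le[of "Tau k"] by auto
  qed
  moreover have "poly_mapping.lookup q (Xi k) \<le> 2 ^ (n + 1 - k) - 1" if "k \<in> {1..n}" for k
    using assms that le[of "Xi k"] by (meson le_trans standard_expo_def)
  ultimately show ?thesis
    using assms unfolding standard_expo_def by blast
qed

lemma nonstandard_ideal_mult:
  assumes "p \<in> nonstandard_ideal n"
  shows "q * p \<in> nonstandard_ideal n"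
proof (induction q rule: poly_mapping_add_induct)
  case (single i c)
  show ?case
    using assms standard_expo_add_right
    by (fastforce simp: nonstandard_ideal_def lookup_single_times)
qed (simp_all add: nonstandard_ideal_def distrib_right lookup_add)

lemma ideal_nonstandard_ideal: "ideal (nonstandard_ideal n) gen_poly_ring"
proof (rule idealI)
  show "ring gen_poly_ring" using cring_gen_poly_ring by (rule cring.axioms)
  interpret abelian_group gen_poly_ring
    using cring_gen_poly_ring by (intro ring.is_abelian_group cring.axioms)
  have inv: "inv\<^bsub>add_monoid gen_poly_ring\<^esub> p = - p" for p
    using minus_equality[of "- p" p] by (simp add: a_inv_def)
  then have inv: "inv\<^bsub>\<lparr>carrier = UNIV, monoid.mult = (+), one = 0\<rparr>\<^esub> p = - p" for p :: gen_poly
    by simp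
  show "subgroup (nonstandard_ideal n) (add_monoid gen_poly_ring)"
    by (rule group.subgroupI[OF a_group])
      (auto simp: inv nonstandard_ideal_def lookup_add intro!: exI[of _ 0])
qed (auto simp: nonstandard_ideal_mult, metis mult.commute nonstandard_ideal_mult)

lemma single_gen_power:
  "Poly_Mapping.single (Poly_Mapping.single g (1::nat)) (1::m2) ^ k =
   Poly_Mapping.single (Poly_Mapping.single g k) 1"
  by (induction k) (simp_all add: mult_single flip: single_add)

lemma scalar_mult_nonstandard:
  assumes "augment c = 0"
  shows "scalar c * p \<in> nonstandard_ideal n"
  using assms by (auto simp: nonstandard_ideal_def scalar_def lookup_single_times)

lemma single_nonstandard:
  assumes "\<not> standard_expo n e"
  shows "Poly_Mapping.single e 1 \<in> nonstandard_ideal n"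
  using assms by (auto simp: nonstandard_ideal_def lookup_single when_def)

lemma nonstandard_closed:
  "p \<in> nonstandard_ideal n \<Longrightarrow> q \<in> nonstandard_ideal n \<Longrightarrow> p + q \<in> nonstandard_ideal n"
  "p \<in> nonstandard_ideal n \<Longrightarrow> q \<in> nonstandard_ideal n \<Longrightarrow> p - q \<in> nonstandard_ideal n"
  by (auto simp: nonstandard_ideal_def lookup_add lookup_minus)

lemma relations_nonstandard: "relations n \<subseteq> nonstandard_ideal n"
proof -
  have "xi i ^ 2 ^ (n - i + 1) \<in> nonstandard_ideal n" if "1 \<le> i" "i \<le> n" for i
  proof -
    have "(2::nat) ^ (n - i + 1) > 2 ^ (n + 1 - i) - 1"
      using that by (simp add: Suc_diff_le)
    moreover have "poly_mapping.lookup e (Xi i) \<le> 2 ^ (n + 1 - i) - 1" if "standard_expo n e" for e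
      using that \<open>1 \<le> i\<close> \<open>i \<le> n\<close> unfolding standard_expo_def by auto
    ultimately have "\<not> standard_expo n (Poly_Mapping.single (Xi i) (2 ^ (n - i + 1)))"
      by (metis leD lookup_single_eq)
    then show ?thesis unfolding xi_def single_gen_power by (rule single_nonstandard)
  qed
  moreover have "(tau i)\<^sup>2 - ((scalar u_m2 + scalar a_m2 * tau 0) * xi (i + 1)
      + scalar a_m2 * tau (i + 1)) \<in> nonstandard_ideal n" if "i \<le> n" for i
  proof -
    have "poly_mapping.lookup e (Tau i) \<in> {0, 1}" if "standard_expo n e" for e
      using that \<open>i \<le> n\<close> unfolding standard_expo_def by auto
    from this[of "Poly_Mapping.single (Tau i) 2"]
    have "\<not> standard_expo n (Poly_Mapping.single (Tau i) 2)" by auto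
    then have "(tau i)\<^sup>2 \<in> nonstandard_ideal n"
      unfolding tau_def single_gen_power by (rule single_nonstandard)
    moreover have "scalar u_m2 * xi (i + 1) + scalar a_m2 * (tau 0 * xi (i + 1))
        + scalar a_m2 * tau (i + 1) \<in> nonstandard_ideal n"
      by (intro nonstandard_closed scalar_mult_nonstandard) simp_all
    ultimately show ?thesis
      by (simp add: nonstandard_closed distrib_right mult.assoc)
  qed
  moreover have "xi i \<in> nonstandard_ideal n" if "i = 0 \<or> n < i" for i
    unfolding xi_def using that by (intro single_nonstandard) (auto simp: standard_expo_def)
  moreover have "tau i \<in> nonstandard_ideal n" if "n < i" for i
    unfolding tau_def using that by (intro single_nonstandard) (auto simp: standard_expo_def)
  ultimately show ?thesis unfolding relations_def by blast
qed

lemma rel_ideal_nonstandard: "rel_ideal n \<subseteq> nonstandard_ideal n"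
  unfolding rel_ideal_def genideal_def
  using ideal_nonstandard_ideal relations_nonstandard by blast

lemma prod_single:
  "finite A \<Longrightarrow> (\<Prod>i\<in>A. Poly_Mapping.single (f i) (1::m2)) = Poly_Mapping.single (\<Sum>i\<in>A. f i :: expo) 1"
  by (induction rule: finite_induct) (simp_all add: mult_single)

lemma monomial_eq:
  assumes "standard_expo n e"
  shows "monomial n e = residue_class n (Poly_Mapping.single e 1)"
proof -
  have "(\<Sum>i=0..n. Poly_Mapping.single (Tau i) (poly_mapping.lookup e (Tau i)))
      + (\<Sum>i=1..n. Poly_Mapping.single (Xi i) (poly_mapping.lookup e (Xi i))) = e"
  proof (rule poly_mapping_eqI)
    fix g
    have out: "poly_mapping.lookup e g = 0" if "g \<notin> Tau ` {0..n} \<union> Xi ` {1..n}"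
      using assms that unfolding standard_expo_def by (meson in_keys_iff subsetD)
    show "poly_mapping.lookup
        ((\<Sum>i=0..n. Poly_Mapping.single (Tau i) (poly_mapping.lookup e (Tau i)))
          + (\<Sum>i=1..n. Poly_Mapping.single (Xi i) (poly_mapping.lookup e (Xi i)))) g
      = poly_mapping.lookup e g"
    proof (cases g)
      case (Tau k)
      have "k \<le> n \<or> poly_mapping.lookup e (Tau k) = 0"
        using out unfolding Tau by fastforce
      then show ?thesis using Tau
        by (auto simp: lookup_add lookup_sum lookup_single when_def)
    next
      case (Xi k)
      have "1 \<le> k \<and> k \<le> n \<or> poly_mapping.lookup e (Xi k) = 0"
        using out unfolding Xi by fastforce
      then show ?thesis using Xi
        by (auto simp: lookup_add lookup_sum lookup_single when_def)
    qed
  qed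
  then show ?thesis
    unfolding monomial_def tau_def xi_def single_gen_power
    by (simp add: prod_single mult_single)
qed

lemma monomial_inject:
  assumes e: "standard_expo n e" and e': "standard_expo n e'"
    and eq: "monomial n e = monomial n e'"
  shows "e = e'"
proof (rule ccontr)
  assume ne: "e \<noteq> e'"
  have "residue_class n (Poly_Mapping.single e 1) = residue_class n (Poly_Mapping.single e' 1)"
    using eq unfolding monomial_eq[OF e] monomial_eq[OF e'] .
  then have "Poly_Mapping.single e 1 - Poly_Mapping.single e' 1 \<in> nonstandard_ideal n"
    using residue_class_eqD rel_ideal_nonstandard by blast
  then have "augment (poly_mapping.lookup
      (Poly_Mapping.single e 1 - Poly_Mapping.single e' 1) e) = 0"
    using e unfolding nonstandard_ideal_def by blast
  moreover have "poly_mapping.lookup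
      (Poly_Mapping.single e 1 - Poly_Mapping.single e' 1) e = (1 :: m2)"
    using ne by (simp add: lookup_minus lookup_single when_def)
  ultimately show False by simp
qed

lemma exponents_monomial:
  assumes "standard_expo n e"
  shows "exponents n (monomial n e) = e"
  unfolding exponents_def
proof (rule the_equality)
  show "standard_expo n e \<and> monomial n e = monomial n e" using assms by simp
  show "e' = e" if "standard_expo n e' \<and> monomial n e = monomial n e'" for e'
    using that assms monomial_inject by metis
qed


lemma exponents_tau:
  assumes "i \<le> n"
  shows "exponents n (residue_class n (tau i)) = Poly_Mapping.single (Tau i) 1"
proof -
  have std: "standard_expo n (Poly_Mapping.single (Tau i) 1)"
    using assms by (auto simp: standard_expo_def lookup_single when_def)
  show ?thesis
    using exponents_monomial[OF std] unfolding monomial_eq[OF std] tau_def .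
qed

lemma mono_dvd_tau_iff:
  assumes "x \<in> standard_monomials n" "i \<le> n"
  shows "mono_dvd n (residue_class n (tau i)) x \<longleftrightarrow> tau_exp n x i = 1"
proof -
  obtain e where e: "standard_expo n e" "x = monomial n e"
    using assms(1) by (auto simp: standard_monomials_def)
  then have ex: "exponents n x = e" by (simp add: exponents_monomial)
  have "poly_mapping.lookup e (Tau i) \<in> {0, 1}"
    using e assms by (auto simp: standard_expo_def)
  then show ?thesis
    by (auto simp: mono_dvd_def ex tau_exp_def exponents_tau[OF assms(2)] lookup_single when_def)
qed


section \<open>The graph of a monomial\<close>

text \<open>\<open>Sgn\<close> is the sign representation, \<open>Reg i\<close> the representation 2^i rho.\<close>

datatype rep = Sgn | Reg nat

fun rep_dim :: "rep \<Rightarrow> nat" where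
  "rep_dim Sgn = 1"
| "rep_dim (Reg i) = 2 ^ (i + 1)"

record ('v, 'l) ugraph =
  uverts :: "'v set"
  uedges :: "('v set \<times> 'l) set"

text \<open>Edges are labelled by the power products tau_i and xi_i^(2^j).\<close>

definition mono_graph :: "nat \<Rightarrow> gen_poly set \<Rightarrow> (rep, expo) ugraph" where
  "mono_graph n x = \<lparr>
     uverts = insert Sgn (Reg ` {0..n}),
     uedges =
       {({Sgn, Reg i}, Poly_Mapping.single (Tau i) 1) |i. i \<le> n \<and> tau_exp n x i = 1} \<union>
       {({Reg j, Reg (i + j)}, Poly_Mapping.single (Xi i) (2 ^ j)) |i j.
          1 \<le> i \<and> i \<le> n \<and> j \<le> n - i \<and> xi_digit n x i j = 1}\<rparr>"

definition orient :: "('v \<Rightarrow> nat) \<Rightarrow> ('v, 'l) ugraph \<Rightarrow> 'v pair_pre_digraph" where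
  "orient d G = \<lparr>
     pverts = uverts G,
     parcs = {(v, w). (\<exists>l. ({v, w}, l) \<in> uedges G) \<and> d v < d w}\<rparr>"

definition mono_digraph :: "nat \<Rightarrow> gen_poly set \<Rightarrow> rep pair_pre_digraph" where
  "mono_digraph n x = orient rep_dim (mono_graph n x)"

definition unilateral :: "('v, 'e) pre_digraph \<Rightarrow> bool" where
  "unilateral G \<longleftrightarrow>
     (\<forall>v\<in>verts G. \<forall>w\<in>verts G. v \<noteq> w \<longrightarrow>
        (\<exists>p. pre_digraph.apath G v p w) \<or> (\<exists>p. pre_digraph.apath G w p v))"


section \<open>Chain sums\<close>

definition chains :: "nat \<Rightarrow> nat \<Rightarrow> nat \<Rightarrow> nat \<Rightarrow> nat list set" where
  "chains n t r s =
     {b. length b = t + 1 \<and> set b \<subseteq> {0..n} \<and> sorted_wrt (<) b \<and> b ! 0 = r \<and> b ! t = s}"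

definition chain_sum :: "nat \<Rightarrow> gen_poly set \<Rightarrow> nat \<Rightarrow> nat \<Rightarrow> int" where
  "chain_sum n x r s =
     (\<Sum>t=1..n. \<Sum>b\<in>chains n t r s.
        \<Prod>k=1..t. int (xi_digit n x (b ! k - b ! (k - 1)) (b ! (k - 1))))"

end

theory Submission
  imports Defs
begin

text \<open>
  Every arc increases the dimension, so a path to \<open>Reg 0\<close>, the vertex of dimension 2,
  can only be the single arc \<open>tau_0\<close> from \<open>Sgn\<close>. No arc enters \<open>Sgn\<close>, so the paths
  from \<open>Reg r\<close> to \<open>Reg s\<close> stay within the vertices \<open>Reg i\<close>; they are the tuples counted by
  the chain sum, whose nonnegative terms are products of binary digits.
\<close>

text \<open>A walk shortens to a path with the same ends, so path existence becomes membership in a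
  closure, which allows induction. Well-formedness keeps every arc within the vertex set.\<close>

lemma unilateral_with_proj_iff:
  assumes "pair_wf_digraph G"
  shows "unilateral (with_proj G) \<longleftrightarrow>
    (\<forall>v\<in>pverts G. \<forall>w\<in>pverts G. v \<noteq> w \<longrightarrow> (v, w) \<in> (parcs G)\<^sup>* \<or> (w, v) \<in> (parcs G)\<^sup>*)"
proof -
  interpret wf_digraph "with_proj G"
    using assms by (simp add: wf_digraph_wp_iff)
  show ?thesis
    by (auto simp: unilateral_def reachable_conv simp flip: reachable_apath)
qed

text \<open>The arcs between regular representations, transported to indices: the arc from
  \<open>Reg j\<close> to \<open>Reg k\<close> is labelled by the generator
  \<open>Xi (k - j)\<close> with exponent \<open>2 ^ j\<close>. This is the form in which digits
  enter \<open>chain_sum\<close>.\<close>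

definition xi_steps :: "nat \<Rightarrow> gen_poly set \<Rightarrow> nat rel" where
  "xi_steps n x = {(j, k). j < k \<and> k \<le> n \<and> xi_digit n x (k - j) j = 1}"

lemma pverts_mono_digraph: "pverts (mono_digraph n x) = insert Sgn (Reg ` {0..n})"
  by (simp add: mono_digraph_def orient_def mono_graph_def)

lemma parcs_mono_digraph:
  "parcs (mono_digraph n x) =
     {(Sgn, Reg i) |i. i \<le> n \<and> tau_exp n x i = 1} \<union> map_prod Reg Reg ` xi_steps n x"
    (is "_ = ?A \<union> ?B")
proof -
  have dim: "1 < rep_dim (Reg i)" for i
    using one_less_power[of "2::nat" "Suc i"] by simp
  have "(v, w) \<in> parcs (mono_digraph n x) \<longleftrightarrow> (v, w) \<in> ?A \<union> ?B" for v w
  proof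
    assume "(v, w) \<in> parcs (mono_digraph n x)"
    then consider
      (tau) i where "{v, w} = {Sgn, Reg i}" "i \<le> n" "tau_exp n x i = 1" "rep_dim v < rep_dim w"
    | (xi) i j where "{v, w} = {Reg j, Reg (i + j)}" "1 \<le> i" "i \<le> n" "j \<le> n - i"
        "xi_digit n x i j = 1" "rep_dim v < rep_dim w"
      by (auto simp: mono_digraph_def orient_def mono_graph_def)
    then show "(v, w) \<in> ?A \<union> ?B"
    proof cases
      case tau
      then show ?thesis using dim[of i] by (auto simp: doubleton_eq_iff)
    next
      case xi
      \<comment> \<open>The opposite orientation would need
        \<open>2 ^ (i + j + 1) < 2 ^ (j + 1)\<close>.\<close>
      then have "v = Reg j" "w = Reg (i + j)"
        by (auto simp: doubleton_eq_iff)
      then show ?thesis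
        using xi by (auto simp: xi_steps_def intro!: image_eqI[where x = "(j, i + j)"])
    qed
  next
    assume "(v, w) \<in> ?A \<union> ?B"
    then consider
      (tau) i where "v = Sgn" "w = Reg i" "i \<le> n" "tau_exp n x i = 1"
    | (xi) j k where "v = Reg j" "w = Reg k" "j < k" "k \<le> n" "xi_digit n x (k - j) j = 1"
      by (auto simp: xi_steps_def)
    then show "(v, w) \<in> parcs (mono_digraph n x)"
    proof cases
      case tau
      then show ?thesis
        using dim[of i] by (auto simp: mono_digraph_def orient_def mono_graph_def)
    next
      case xi
      \<comment> \<open>The label is recovered from the endpoints; \<open>k \<le> n\<close> becomes
        the bound \<open>j \<le> n - i\<close> on digit positions.\<close>
      define i where "i = k - j"
      have "k = i + j" "1 \<le> i" "i \<le> n" "j \<le> n - i"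
        using xi by (auto simp: i_def)
      moreover have "xi_digit n x i j = 1" using xi by (simp add: i_def)
      ultimately have "({v, w}, Poly_Mapping.single (Xi i) (2 ^ j)) \<in> uedges (mono_graph n x)"
        using xi by (auto simp: mono_graph_def)
      moreover have "rep_dim v < rep_dim w" using xi by simp
      ultimately show ?thesis by (auto simp: mono_digraph_def orient_def)
    qed
  qed
  then show ?thesis by auto
qed

lemma pair_wf_digraph_mono_digraph: "pair_wf_digraph (mono_digraph n x)"
  by unfold_locales (auto simp: pverts_mono_digraph parcs_mono_digraph xi_steps_def)

lemma xi_steps_rtrancl_le: "(r, s) \<in> (xi_steps n x)\<^sup>* \<Longrightarrow> r \<le> s"
  by (induction rule: rtrancl_induct) (auto simp: xi_steps_def)

text \<open>The endpoint \<open>w\<close> is left arbitrary so that the case \<open>w = Sgn\<close>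
  is excluded as well.\<close>

lemma Reg_path_stays_Reg:
  assumes "(Reg r, w) \<in> (parcs (mono_digraph n x))\<^sup>*"
  shows "\<exists>s. w = Reg s \<and> (r, s) \<in> (xi_steps n x)\<^sup>*"
  using assms
proof (induction rule: rtrancl_induct)
  case (step y z)
  then obtain s where s: "y = Reg s" "(r, s) \<in> (xi_steps n x)\<^sup>*" by blast
  obtain t where t: "z = Reg t" "(s, t) \<in> xi_steps n x"
    using step.hyps(2) s(1) by (auto simp: parcs_mono_digraph)
  have "(r, t) \<in> (xi_steps n x)\<^sup>*"
    using s(2) t(2) by (rule rtrancl_into_rtrancl)
  with t(1) show ?case by simp
qed simp

lemma Reg_path_iff:
  "(Reg r, Reg s) \<in> (parcs (mono_digraph n x))\<^sup>* \<longleftrightarrow> (r, s) \<in> (xi_steps n x)\<^sup>*"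
proof
  assume "(r, s) \<in> (xi_steps n x)\<^sup>*"
  then show "(Reg r, Reg s) \<in> (parcs (mono_digraph n x))\<^sup>*"
  proof (induction rule: rtrancl_induct)
    case (step s t)
    have "(Reg s, Reg t) \<in> parcs (mono_digraph n x)"
      using step.hyps(2) by (auto simp: parcs_mono_digraph)
    with step.IH show ?case by (rule rtrancl_into_rtrancl)
  qed simp
next
  assume "(Reg r, Reg s) \<in> (parcs (mono_digraph n x))\<^sup>*"
  then show "(r, s) \<in> (xi_steps n x)\<^sup>*"
    using Reg_path_stays_Reg by blast
qed

lemma Sgn_path_Reg_0_iff:
  "(Sgn, Reg 0) \<in> (parcs (mono_digraph n x))\<^sup>* \<longleftrightarrow> tau_exp n x 0 = 1"
proof
  assume "(Sgn, Reg 0) \<in> (parcs (mono_digraph n x))\<^sup>*"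
  then obtain w where w: "(Sgn, w) \<in> parcs (mono_digraph n x)"
      "(w, Reg 0) \<in> (parcs (mono_digraph n x))\<^sup>*"
    by (rule converse_rtranclE) simp
  then obtain i where i: "tau_exp n x i = 1" "(Reg i, Reg 0) \<in> (parcs (mono_digraph n x))\<^sup>*"
    by (auto simp: parcs_mono_digraph)
  \<comment> \<open>After the first arc, the index never decreases along the path.\<close>
  then have "i \<le> 0"
    using xi_steps_rtrancl_le[of i 0 n x] Reg_path_iff[of i 0 n x] by simp
  then show "tau_exp n x 0 = 1" using i by simp
next
  assume "tau_exp n x 0 = 1"
  then have "(Sgn, Reg 0) \<in> parcs (mono_digraph n x)"
    by (simp add: parcs_mono_digraph)
  then show "(Sgn, Reg 0) \<in> (parcs (mono_digraph n x))\<^sup>*" by blast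
qed

text \<open>For each pair of vertices only one direction is possible: from smaller to larger index,
  and from \<open>Sgn\<close> to \<open>Reg\<close>. The pair \<open>Sgn\<close>,
  \<open>Reg 0\<close> yields the condition on \<open>tau_0\<close>.\<close>

lemma unilateral_mono_digraph_iff:
  "unilateral (with_proj (mono_digraph n x)) \<longleftrightarrow>
     (\<forall>r s. r < s \<and> s \<le> n \<longrightarrow> (r, s) \<in> (xi_steps n x)\<^sup>*) \<and> tau_exp n x 0 = 1"
    (is "?U \<longleftrightarrow> ?R \<and> ?T")
proof -
  define P where "P = (parcs (mono_digraph n x))\<^sup>*"
  have U: "?U \<longleftrightarrow> (\<forall>v \<in> pverts (mono_digraph n x). \<forall>w \<in> pverts (mono_digraph n x).
      v \<noteq> w \<longrightarrow> (v, w) \<in> P \<or> (w, v) \<in> P)"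
    unfolding P_def by (rule unilateral_with_proj_iff[OF pair_wf_digraph_mono_digraph])
  have Reg: "(Reg r, Reg s) \<in> P \<longleftrightarrow> (r, s) \<in> (xi_steps n x)\<^sup>*" for r s
    unfolding P_def by (rule Reg_path_iff)
  have Reg_Sgn: "(Reg r, Sgn) \<notin> P" for r
    using Reg_path_stays_Reg[of r Sgn n x] unfolding P_def by auto
  have Sgn: "(Sgn, Reg 0) \<in> P \<longleftrightarrow> ?T"
    unfolding P_def by (rule Sgn_path_Reg_0_iff)
  show ?thesis
  proof
    assume ?U
    have "(r, s) \<in> (xi_steps n x)\<^sup>*" if "r < s" "s \<le> n" for r s
    proof -
      have "(Reg r, Reg s) \<in> P \<or> (Reg s, Reg r) \<in> P"
        using \<open>?U\<close> that unfolding U by (simp add: pverts_mono_digraph)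
      moreover have "(s, r) \<notin> (xi_steps n x)\<^sup>*"
        using xi_steps_rtrancl_le[of s r n x] \<open>r < s\<close> by linarith
      ultimately show ?thesis unfolding Reg by blast
    qed
    moreover have ?T
      using \<open>?U\<close> Reg_Sgn unfolding U Sgn[symmetric] by (simp add: pverts_mono_digraph)
    ultimately show "?R \<and> ?T" by blast
  next
    assume RT: "?R \<and> ?T"
    have R: "(Reg r, Reg s) \<in> P" if "r \<le> s" "s \<le> n" for r s
      using that RT by (cases "r = s") (simp_all add: Reg)
    \<comment> \<open>The arc \<open>tau_0\<close> leads to \<open>Reg 0\<close>, from which every
      \<open>Reg s\<close> is reachable.\<close>
    have S: "(Sgn, Reg s) \<in> P" if "s \<le> n" for s
    proof -
      have "(Sgn, Reg 0) \<in> P" "(Reg 0, Reg s) \<in> P"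
        using RT R[of 0 s] that Sgn by simp_all
      then show ?thesis unfolding P_def by (rule rtrancl_trans)
    qed
    have "(Reg r, Reg s) \<in> P \<or> (Reg s, Reg r) \<in> P" if "r \<le> n" "s \<le> n" for r s
      using R[of r s] R[of s r] that linear[of r s] by blast
    then show ?U
      unfolding U by (simp add: pverts_mono_digraph S)
  qed
qed

lemma finite_chains: "finite (chains n t r s)"
  by (rule finite_subset[OF _ finite_lists_length_eq[of "{0..n}" "t + 1"]])
    (auto simp: chains_def)

text \<open>The \<open>t + 1\<close> entries are distinct elements of a set of size
  \<open>n + 1\<close>. Hence the range of \<open>t\<close> in \<open>chain_sum\<close> already
  covers chains of every positive length.\<close>

lemma chains_length_le:
  assumes "b \<in> chains n t r s"
  shows "t \<le> n"
proof -
  have "t + 1 = card (set b)"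
    using assms by (auto simp: chains_def strict_sorted_iff distinct_card)
  also have "\<dots> \<le> card {0..n}"
    using assms by (intro card_mono) (auto simp: chains_def)
  finally show ?thesis by simp
qed

lemma chain_sum_pos_iff:
  "chain_sum n x r s > 0 \<longleftrightarrow>
     (\<exists>t \<ge> 1. \<exists>b \<in> chains n t r s. \<forall>k < t. xi_digit n x (b ! Suc k - b ! k) (b ! k) = 1)"
    (is "_ \<longleftrightarrow> (\<exists>t \<ge> 1. \<exists>b \<in> _. ?D t b)")
proof -
  define w where "w t b = (\<Prod>k=1..t. int (xi_digit n x (b ! k - b ! (k - 1)) (b ! (k - 1))))"
    for t and b :: "nat list"
  have w_nonneg: "0 \<le> w t b" for t b
    unfolding w_def by (intro prod_nonneg) simp
  have w_nonzero: "w t b \<noteq> 0 \<longleftrightarrow> ?D t b" for t b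
  proof -
    \<comment> \<open>Counting steps from 0 matches the description of relational powers by
      sequences.\<close>
    have "w t b = (\<Prod>k<t. int (xi_digit n x (b ! Suc k - b ! k) (b ! k)))"
      unfolding w_def by (rule prod.reindex_bij_witness[of _ Suc "\<lambda>k. k - 1"]) auto
    then have "w t b \<noteq> 0 \<longleftrightarrow> (\<forall>k<t. xi_digit n x (b ! Suc k - b ! k) (b ! k) \<noteq> 0)"
      by auto
    also have "\<dots> \<longleftrightarrow> ?D t b"
      \<comment> \<open>A digit is a residue modulo 2, so nonzero means 1.\<close>
      by (auto simp: xi_digit_def)
    finally show ?thesis .
  qed
  have "chain_sum n x r s = (\<Sum>t=1..n. \<Sum>b\<in>chains n t r s. w t b)"
    by (simp add: chain_sum_def w_def)
  \<comment> \<open>As one finite sum over pairs, it vanishes exactly when all its nonnegative terms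
    do.\<close>
  also have "\<dots> = (\<Sum>(t, b)\<in>Sigma {1..n} (\<lambda>t. chains n t r s). w t b)"
    by (simp add: sum.Sigma finite_chains)
  finally have sum: "chain_sum n x r s = \<dots>" .
  have "0 \<le> (\<Sum>(t, b)\<in>Sigma {1..n} (\<lambda>t. chains n t r s). w t b)"
    by (intro sum_nonneg) (auto simp: w_nonneg)
  moreover have "(\<Sum>(t, b)\<in>Sigma {1..n} (\<lambda>t. chains n t r s). w t b) = 0 \<longleftrightarrow>
      (\<forall>(t, b)\<in>Sigma {1..n} (\<lambda>t. chains n t r s). w t b = 0)"
    by (subst sum_nonneg_eq_0_iff) (auto simp: w_nonneg finite_chains)
  ultimately have "chain_sum n x r s > 0 \<longleftrightarrow> (\<exists>t \<in> {1..n}. \<exists>b \<in> chains n t r s. w t b \<noteq> 0)"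
    unfolding sum order.strict_iff_order by auto
  also have "\<dots> \<longleftrightarrow> (\<exists>t \<ge> 1. \<exists>b \<in> chains n t r s. ?D t b)"
    unfolding w_nonzero by (meson atLeastAtMost_iff chains_length_le)
  finally show ?thesis .
qed

text \<open>A path of \<open>t\<close> steps is the same thing as a sequence of \<open>t + 1\<close>
  indices, and all digits along a chain equal 1 exactly when its consecutive entries are
  steps.\<close>

lemma chain_sum_pos_iff_path:
  assumes "r < s" "s \<le> n"
  shows "chain_sum n x r s > 0 \<longleftrightarrow> (r, s) \<in> (xi_steps n x)\<^sup>*"
proof
  assume "chain_sum n x r s > 0"
  then obtain t b where b: "b \<in> chains n t r s"
    and digits: "\<And>k. k < t \<Longrightarrow> xi_digit n x (b ! Suc k - b ! k) (b ! k) = 1"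
    unfolding chain_sum_pos_iff by blast
  have "(b ! k, b ! Suc k) \<in> xi_steps n x" if "k < t" for k
  proof -
    have "b ! k < b ! Suc k"
      using b that by (auto simp: chains_def sorted_wrt_nth_less)
    moreover have "b ! Suc k \<in> set b" using b that by (simp add: chains_def)
    then have "b ! Suc k \<le> n" using b by (auto simp: chains_def)
    ultimately show ?thesis using digits[OF that] by (simp add: xi_steps_def)
  qed
  then have "(b ! 0, b ! t) \<in> xi_steps n x ^^ t"
    unfolding relpow_fun_conv by (intro exI[of _ "(!) b"]) simp
  then show "(r, s) \<in> (xi_steps n x)\<^sup>*"
    using b by (auto simp: chains_def dest: relpow_imp_rtrancl)
next
  assume "(r, s) \<in> (xi_steps n x)\<^sup>*"
  then obtain t where "(r, s) \<in> xi_steps n x ^^ t"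
    using rtrancl_imp_relpow by blast
  then obtain f where f: "f 0 = r" "f t = s" "\<And>k. k < t \<Longrightarrow> (f k, f (Suc k)) \<in> xi_steps n x"
    by (auto simp: relpow_fun_conv)
  define b where "b = map f [0..<Suc t]"
  have nth: "b ! k = f k" if "k \<le> t" for k
    using that unfolding b_def by (subst nth_map) (auto simp del: upt_Suc)
  \<comment> \<open>The empty path is excluded because its ends would coincide.\<close>
  have "t \<ge> 1" using f(1,2) assms(1) by (cases t) auto
  \<comment> \<open>Before the end, \<open>f k\<close> lies below its successor, which a step bounds
    by \<open>n\<close>; the last entry is \<open>s\<close>.\<close>
  have "f k \<le> n" if "k \<le> t" for k
    using f(2) f(3)[of k] that assms by (cases "k = t") (auto simp: xi_steps_def)
  moreover have "sorted_wrt (<) b"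
    using f(3) nth by (auto simp: sorted_wrt_iff_nth_Suc_transp xi_steps_def b_def simp del: upt_Suc)
  ultimately have "b \<in> chains n t r s"
    using f(1,2) nth by (auto simp: chains_def b_def simp del: upt_Suc)
  moreover have "xi_digit n x (b ! Suc k - b ! k) (b ! k) = 1" if "k < t" for k
    using f(3)[OF that] that by (simp add: nth xi_steps_def)
  ultimately show "chain_sum n x r s > 0"
    unfolding chain_sum_pos_iff using \<open>t \<ge> 1\<close> by blast
qed

theorem theorem4p7:
  fixes n :: nat and x :: "gen_poly set"
  assumes "x \<in> standard_monomials n"
  shows "unilateral (with_proj (mono_digraph n x)) \<longleftrightarrow>
    (\<forall>r s. r < s \<and> s \<le> n \<longrightarrow> chain_sum n x r s > 0) \<and>
    mono_dvd n (residue_class n (tau 0)) x"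
  unfolding unilateral_mono_digraph_iff mono_dvd_tau_iff[OF assms le0]
  \<comment> \<open>The congruence rules supply \<open>r < s\<close> and \<open>s \<le> n\<close>
    while the chain sum is rewritten.\<close>
  by (simp add: chain_sum_pos_iff_path cong: imp_cong conj_cong)

end
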